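(* There exist absolute constants $c>0$ and $c'>0$ such that for every prime $q$ there exists a minimal blocking set in $\mathrm{PG}(2,q)$ of size at least $c'\,q^{1+c}$; that is, $B(2,q)\ge c'\,q^{1+c}$.
   Context: $\mathrm{PG}(2,q)$ is the projective plane over $\mathbb{F}_q$. A set of points $B\subset\mathrm{PG}(2,q)$ is a blocking set if $\ell\cap B\ne\emptyset$ for every line $\ell$ of $\mathrm{PG}(2,q)$; it is a minimal blocking set if it is a blocking set and no proper subset of $B$ is a blocking set. $B(2,q)$ denotes the maximum cardinality of a minimal blocking set in $\mathrm{PG}(2,q)$. *)

theory Defs
  imports Complex_Main "HOL-Number_Theory.Residues"
begin

text \<open>The projective plane over a field \<open>F\<close>, in homogeneous coordinates: a point is a
  one-dimensional subspace of the space of coordinate triples, and a line is the set of all points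
  lying in the kernel of a nonzero linear form, that is, in a two-dimensional subspace.\<close>

definition nonzero_triples :: "('a, 'm) ring_scheme \<Rightarrow> ('a \<times> 'a \<times> 'a) set" where
  "nonzero_triples F =
     carrier F \<times> carrier F \<times> carrier F - {(\<zero>\<^bsub>F\<^esub>, \<zero>\<^bsub>F\<^esub>, \<zero>\<^bsub>F\<^esub>)}"

definition pg_point :: "('a, 'm) ring_scheme \<Rightarrow> 'a \<times> 'a \<times> 'a \<Rightarrow> ('a \<times> 'a \<times> 'a) set" where
  "pg_point F = (\<lambda>(x, y, z). {(t \<otimes>\<^bsub>F\<^esub> x, t \<otimes>\<^bsub>F\<^esub> y, t \<otimes>\<^bsub>F\<^esub> z) |t. t \<in> carrier F})"

definition pg_points :: "('a, 'm) ring_scheme \<Rightarrow> ('a \<times> 'a \<times> 'a) set set" where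
  "pg_points F = pg_point F ` nonzero_triples F"

definition pg_line :: "('a, 'm) ring_scheme \<Rightarrow> 'a \<times> 'a \<times> 'a \<Rightarrow> ('a \<times> 'a \<times> 'a) set set" where
  "pg_line F = (\<lambda>(a, b, c). {P \<in> pg_points F.
     \<forall>(x, y, z) \<in> P. a \<otimes>\<^bsub>F\<^esub> x \<oplus>\<^bsub>F\<^esub> b \<otimes>\<^bsub>F\<^esub> y \<oplus>\<^bsub>F\<^esub> c \<otimes>\<^bsub>F\<^esub> z = \<zero>\<^bsub>F\<^esub>})"

definition pg_lines :: "('a, 'm) ring_scheme \<Rightarrow> ('a \<times> 'a \<times> 'a) set set set" where
  "pg_lines F = pg_line F ` nonzero_triples F"

definition blocking_set :: "('a, 'm) ring_scheme \<Rightarrow> ('a \<times> 'a \<times> 'a) set set \<Rightarrow> bool" where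
  "blocking_set F B \<longleftrightarrow> B \<subseteq> pg_points F \<and> (\<forall>l \<in> pg_lines F. l \<inter> B \<noteq> {})"

definition minimal_blocking_set :: "('a, 'm) ring_scheme \<Rightarrow> ('a \<times> 'a \<times> 'a) set set \<Rightarrow> bool" where
  "minimal_blocking_set F B \<longleftrightarrow> blocking_set F B \<and> (\<forall>C. C \<subset> B \<longrightarrow> \<not> blocking_set F C)"

text \<open>The quantity \<open>B(2,q)\<close> for a field \<open>F\<close> with \<open>q\<close> elements. It is meaningful only for
  finite \<open>F\<close>; there the set of cardinalities is finite and nonempty.\<close>

definition max_minimal_blocking_size :: "('a, 'm) ring_scheme \<Rightarrow> nat" where
  "max_minimal_blocking_size F = Max (card ` {B. minimal_blocking_set F B})"

end

theory Submission
  imports Defs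
begin

text \<open>Take lines with equations \<open>\<sigma>\<^sub>i x + y + t z = 0\<close>, where \<open>i\<close> ranges over an index set \<open>I\<close> and \<open>t\<close>
  over \<open>R \<subseteq> \<int>/p\<close>, and on each of them the point \<open>(\<alpha>\<^sub>i, - \<alpha>\<^sub>i \<sigma>\<^sub>i - t, 1)\<close>. If \<open>\<alpha>\<^sub>i (\<sigma>\<^sub>j - \<sigma>\<^sub>i)\<close> avoids
  \<open>R - R\<close> for \<open>i \<noteq> j\<close>, each of these lines meets the set of chosen points only in its own point.
  Removing from the plane all other points of these lines leaves a blocking set, because the
  removed set misses \<open>(0, 1, 0)\<close>, all points at infinity of the remaining directions, and the points
  \<open>(0, - t, 1)\<close> with \<open>t \<notin> R\<close>. Every minimal blocking set inside it contains all \<open>|I| |R|\<close> chosen points.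

  To get \<open>|I| |R|\<close> much larger than \<open>p\<close>, let \<open>I\<close> be the box \<open>[0, m)\<^sup>3\<close> and write \<open>\<sigma>\<close> and \<open>\<alpha>\<close> in a base \<open>T\<close> of
  order \<open>m\<^sup>2\<close>, with few digits, so that the coefficient of \<open>T\<^sup>3\<close> in \<open>\<alpha>\<^sub>x (\<sigma>\<^sub>y - \<sigma>\<^sub>x)\<close> is \<open>|x - y|\<^sup>2\<close>. It is
  positive and there are no carries into it, so \<open>R\<close> may consist of all numbers below \<open>p/2\<close> whose
  residue modulo \<open>T\<^sup>4\<close> is less than \<open>T\<^sup>3/2\<close>. This set has density of order \<open>1/T\<close>, while \<open>|I| = m\<^sup>3\<close> is of
  order \<open>T\<^bsup>3/2\<^esup>\<close>.\<close>

section \<open>Incidence over a prime field in integer coordinates\<close>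

definition pg_incident_form :: "int \<times> int \<times> int \<Rightarrow> int \<times> int \<times> int \<Rightarrow> int" where
  "pg_incident_form = (\<lambda>(a, b, c) (x, y, z). a * x + b * y + c * z)"

text \<open>Points and lines can thus be named by arbitrary integer expressions, and incidence
  becomes divisibility of an integer by \<open>p\<close>.\<close>

definition reduce :: "int \<Rightarrow> int \<times> int \<times> int \<Rightarrow> int \<times> int \<times> int" where
  "reduce p = (\<lambda>(x, y, z). (x mod p, y mod p, z mod p))"

context residues_prime
begin

lemma reduce_nonzero_iff:
  "reduce p (x, y, z) \<in> nonzero_triples R \<longleftrightarrow> \<not> (int p dvd x \<and> int p dvd y \<and> int p dvd z)"
  using m_gt_one
  by (auto simp: reduce_def nonzero_triples_def res_carrier_eq res_zero_eq dvd_eq_mod_eq_0)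

lemma nonzero_triples_reduce:
  "v \<in> nonzero_triples R \<Longrightarrow> reduce p v = v"
  by (auto simp: reduce_def nonzero_triples_def res_carrier_eq)

lemma pg_point_mem_points:
  "reduce p v \<in> nonzero_triples R \<Longrightarrow> pg_point R (reduce p v) \<in> pg_points R"
  by (auto simp: pg_points_def)

text \<open>A point consists of all multiples of \<open>v\<close>. The form takes at
  \<open>t v\<close> the value \<open>t\<close> times its value at \<open>v\<close>, and
  \<open>t = 1\<close> gives the forward direction.\<close>

lemma pg_point_mem_line_iff:
  assumes "reduce p v \<in> nonzero_triples R"
  shows "pg_point R (reduce p v) \<in> pg_line R (reduce p u) \<longleftrightarrow> int p dvd pg_incident_form u v"
proof -
  obtain x y z where v: "v = (x, y, z)" by (cases v)
  obtain a b c where u: "u = (a, b, c)" by (cases u)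
  have eq: "a mod p \<otimes> (t \<otimes> (x mod p)) \<oplus> b mod p \<otimes> (t \<otimes> (y mod p)) \<oplus> c mod p \<otimes> (t \<otimes> (z mod p))
      = (t * (a * x + b * y + c * z)) mod p" for t
  proof -
    have "a mod p \<otimes> (t \<otimes> (x mod p)) \<oplus> b mod p \<otimes> (t \<otimes> (y mod p)) \<oplus> c mod p \<otimes> (t \<otimes> (z mod p))
      = (a * (t * x) + b * (t * y) + c * (t * z)) mod p"
      by (simp add: res_mult_eq res_add_eq mod_simps)
    also have "a * (t * x) + b * (t * y) + c * (t * z) = t * (a * x + b * y + c * z)"
      by (simp add: algebra_simps)
    finally show ?thesis .
  qed
  have "pg_point R (reduce p v) \<in> pg_line R (reduce p u) \<longleftrightarrow>
     (\<forall>t\<in>carrier R. (t * (a * x + b * y + c * z)) mod p = 0)"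
    using pg_point_mem_points[OF assms]
    unfolding u v pg_line_def reduce_def pg_point_def res_zero_eq prod.case eq[symmetric]
    by blast
  also have "\<dots> \<longleftrightarrow> int p dvd a * x + b * y + c * z"
  proof
    assume "\<forall>t\<in>carrier R. (t * (a * x + b * y + c * z)) mod p = 0"
    moreover have "1 \<in> carrier R" using m_gt_one by (simp add: res_carrier_eq)
    ultimately show "int p dvd a * x + b * y + c * z" by (metis dvd_eq_mod_eq_0 mult_1)
  qed auto
  finally show ?thesis by (simp add: u v pg_incident_form_def)
qed

lemma finite_pg_points: "finite (pg_points R)"
  by (simp add: pg_points_def nonzero_triples_def finite)

lemma finite_minimal_blocking_sets: "finite {B. minimal_blocking_set R B}"
  by (rule finite_subset[of _ "Pow (pg_points R)"])
    (auto simp: minimal_blocking_set_def blocking_set_def finite_pg_points)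

lemma blocking_set_contains_minimal:
  assumes "blocking_set R X"
  shows "\<exists>B\<subseteq>X. minimal_blocking_set R B"
proof -
  let ?F = "{B. blocking_set R B}"
  have "finite ?F"
    by (rule finite_subset[of _ "Pow (pg_points R)"]) (auto simp: blocking_set_def finite_pg_points)
  moreover have "X \<in> ?F" using assms by simp
  ultimately obtain B where B: "B \<in> ?F" "B \<subseteq> X" "\<forall>C\<in>?F. C \<subseteq> B \<longrightarrow> B = C"
    using finite_has_minimal2[of ?F X] by metis
  then have "minimal_blocking_set R B"
    by (auto simp: minimal_blocking_set_def)
  with B(2) show ?thesis by blast
qed

section \<open>Blocking sets from a family of tangents\<close>

lemma minimal_blocking_set_from_tangents:
  fixes \<sigma> \<alpha> :: "'i \<Rightarrow> int" and A :: "int set"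
  assumes A: "A \<subseteq> {0..<int p}"
    and tangent: "\<And>i j t t'. i \<in> I \<Longrightarrow> j \<in> I \<Longrightarrow> t \<in> A \<Longrightarrow> t' \<in> A \<Longrightarrow>
      int p dvd \<alpha> i * (\<sigma> j - \<sigma> i) + (t' - t) \<Longrightarrow> i = j"
  shows "\<exists>B. minimal_blocking_set R B \<and> card I * card A \<le> card B"
proof -
  define line where "line = (\<lambda>(i, t). pg_line R (reduce p (\<sigma> i, 1, t)))"
  define pt where "pt = (\<lambda>(i, t). pg_point R (reduce p (\<alpha> i, - \<alpha> i * \<sigma> i - t, 1)))"
  \<comment> \<open>On \<open>line f\<close> only \<open>pt f\<close> survives in \<open>X\<close>,
    so every blocking set inside \<open>X\<close> must contain \<open>pt f\<close>.\<close>
  define X where "X = {P \<in> pg_points R. \<forall>f \<in> I \<times> A. P \<in> line f \<longrightarrow> P = pt f}"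
  have not_dvd_1: "\<not> int p dvd 1" "p \<noteq> Suc 0"
    using m_gt_one by (auto simp: zdvd1_eq)
  have A_cong: "t = t'" if "int p dvd t' - t" "t \<in> A" "t' \<in> A" for t t'
  proof -
    have "t' mod p = t mod p" using that(1) by (simp add: mod_eq_dvd_iff)
    with that A show ?thesis by (auto simp: subset_iff)
  qed
  have pt_on_line: "pt (i, t) \<in> line (j, t') \<longleftrightarrow> int p dvd \<alpha> i * (\<sigma> j - \<sigma> i) + (t' - t)" for i j t t'
  proof -
    have form: "pg_incident_form (\<sigma> j, 1, t') (\<alpha> i, - (\<alpha> i * \<sigma> i) - t, 1) = \<alpha> i * (\<sigma> j - \<sigma> i) + (t' - t)"
      by (simp add: pg_incident_form_def algebra_simps)
    show ?thesis
      by (simp add: pt_def line_def pg_point_mem_line_iff reduce_nonzero_iff not_dvd_1 form)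
  qed
  have pt_on_line_eq: "f = g" if "f \<in> I \<times> A" "g \<in> I \<times> A" "pt f \<in> line g" for f g
  proof -
    obtain i t j t' where fg: "f = (i, t)" "g = (j, t')" by (cases f, cases g)
    have *: "int p dvd \<alpha> i * (\<sigma> j - \<sigma> i) + (t' - t)"
      using that(3) by (simp add: fg pt_on_line)
    with that tangent have "i = j" by (auto simp: fg)
    with * that A_cong[of t' t] show ?thesis by (auto simp: fg)
  qed
  have own_line: "pt f \<in> line f" for f
    by (cases f) (simp add: pt_on_line)
  have pt_points: "pt f \<in> pg_points R" for f
    by (cases f) (simp add: pt_def pg_point_mem_points reduce_nonzero_iff not_dvd_1)
  have "l \<inter> X \<noteq> {}" if l_line: "l \<in> pg_lines R" for l
  proof -
    from l_line obtain a b c where abc: "(a, b, c) \<in> nonzero_triples R" and "l = pg_line R (a, b, c)"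
      by (auto simp: pg_lines_def)
    then have l: "l = pg_line R (reduce p (a, b, c))"
      by (simp add: nonzero_triples_reduce)
    show ?thesis
    \<comment> \<open>If \<open>p\<close> divides \<open>b\<close>, then \<open>l\<close> passes
      through \<open>(0, 1, 0)\<close>, which is on none of the lines \<open>line f\<close>, as
      their middle coefficient is 1. Otherwise \<open>l\<close> is normalized to
      \<open>s x + y + t z = 0\<close>, with \<open>t\<close> reduced so that it can be compared
      with \<open>A\<close>.\<close>
    proof (cases "int p dvd b")
      case True
      have "pg_point R (reduce p (0, 1, 0)) \<in> l \<inter> X" using True not_dvd_1
        by (auto simp: l X_def line_def pg_point_mem_line_iff reduce_nonzero_iff pg_incident_form_def
            pg_point_mem_points)
      then show ?thesis by blast
    next
      case False
      then have "coprime b (int p)"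
        using p_prime prime_imp_coprime[of "int p" b] by (simp add: coprime_commute)
      then obtain b' where b': "[b * b' = 1] (mod int p)"
        using cong_solve_coprime_int by blast
      define s where "s = a * b'"
      define t where "t = (c * b') mod p"
      have on_l: "pg_point R (reduce p (x, y, z)) \<in> l"
        if "s * x + y + t * z = 0" "reduce p (x, y, z) \<in> nonzero_triples R" for x y z
      proof -
        have bs: "[b * s = a] (mod p)"
          using cong_scalar_left[OF b', of a] by (simp add: s_def algebra_simps)
        have "[b * t = b * (c * b')] (mod p)"
          unfolding t_def by (intro cong_scalar_left) (simp add: cong_def)
        also have "[b * (c * b') = c] (mod p)"
          using cong_scalar_left[OF b', of c] by (simp add: algebra_simps)
        finally have bt: "[b * t = c] (mod p)" .
        have "[(b * s) * x + b * y + (b * t) * z = a * x + b * y + c * z] (mod p)"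
          by (intro cong_add cong_scalar_right bs bt cong_refl)
        moreover have "(b * s) * x + b * y + (b * t) * z = b * (s * x + y + t * z)"
          by (simp add: algebra_simps)
        ultimately have "int p dvd a * x + b * y + c * z"
          using that(1) by (metis cong_0_iff cong_sym mult_zero_right)
        then show ?thesis
          using that(2) by (simp add: l pg_point_mem_line_iff pg_incident_form_def)
      qed
      \<comment> \<open>A new direction \<open>s\<close> leaves the point at infinity of
        \<open>l\<close> in \<open>X\<close>. If \<open>t\<close> is not in \<open>A\<close>, the
        point \<open>(0, - t, 1)\<close> survives. Otherwise \<open>l\<close> is one of the chosen
        lines and contains its own point.\<close>
      consider "\<forall>j\<in>I. \<not> int p dvd \<sigma> j - s" | "t \<notin> A" | i where "i \<in> I" "int p dvd \<sigma> i - s" "t \<in> A"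
        by blast
      then show ?thesis
      proof cases
        case 1
        have nz: "reduce p (1, - s, 0) \<in> nonzero_triples R"
          by (simp add: reduce_nonzero_iff not_dvd_1)
        have "pg_point R (reduce p (1, - s, 0)) \<in> X"
          using 1 nz by (auto simp: X_def line_def pg_point_mem_line_iff pg_incident_form_def
              pg_point_mem_points)
        moreover have "pg_point R (reduce p (1, - s, 0)) \<in> l"
          by (rule on_l) (simp_all add: nz)
        ultimately show ?thesis by blast
      next
        case 2
        have t: "t \<in> {0..<int p}" using m_gt_one by (simp add: t_def)
        have t': "t = t'" if "t' \<in> A" "int p dvd t' - t" for t'
        proof -
          have "t' mod p = t mod p" using that(2) by (simp add: mod_eq_dvd_iff)
          with t that(1) A show ?thesis by (auto simp: subset_iff)
        qed
        have nz: "reduce p (0, - t, 1) \<in> nonzero_triples R"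
          by (simp add: reduce_nonzero_iff not_dvd_1)
        have "pg_point R (reduce p (0, - t, 1)) \<in> X"
          using 2 nz t' by (auto simp: X_def line_def pg_point_mem_line_iff pg_incident_form_def
              pg_point_mem_points)
        moreover have "pg_point R (reduce p (0, - t, 1)) \<in> l"
          by (rule on_l) (simp_all add: nz)
        ultimately show ?thesis by blast
      next
        case 3
        \<comment> \<open>Here \<open>\<sigma> i\<close> is only congruent to \<open>s\<close>; the
          point is rewritten with \<open>s\<close> because \<open>on_l\<close> asks for an exact
          equation.\<close>
        define v :: "int \<times> int \<times> int" where "v = (\<alpha> i, - \<alpha> i * s - t, 1)"
        have "[- \<alpha> i * \<sigma> i - t = - \<alpha> i * s - t] (mod p)"
          using 3(2) by (intro cong_diff cong_scalar_left cong_refl) (simp add: cong_iff_dvd_diff)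
        then have v: "pt (i, t) = pg_point R (reduce p v)"
          by (simp add: pt_def v_def reduce_def cong_def)
        have "pt (i, t) \<in> l"
          unfolding v unfolding v_def
          by (rule on_l) (simp_all add: reduce_nonzero_iff not_dvd_1 algebra_simps)
        moreover have "pt (i, t) \<in> X"
          using pt_points pt_on_line_eq[of "(i, t)"] 3 by (auto simp: X_def)
        ultimately show ?thesis by blast
      qed
    qed
  qed
  then have "blocking_set R X"
    by (auto simp: blocking_set_def X_def)
  then obtain B where B: "B \<subseteq> X" "minimal_blocking_set R B"
    using blocking_set_contains_minimal by blast
  have "pt ` (I \<times> A) \<subseteq> B"
  proof
    fix P assume "P \<in> pt ` (I \<times> A)"
    then obtain i t where f: "(i, t) \<in> I \<times> A" "P = pt (i, t)" by auto
    have "line (i, t) \<in> pg_lines R"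
      by (auto simp: line_def pg_lines_def reduce_nonzero_iff not_dvd_1)
    then have "line (i, t) \<inter> B \<noteq> {}"
      using B(2) by (auto simp: minimal_blocking_set_def blocking_set_def)
    then show "P \<in> B" using B(1) f by (auto simp: X_def)
  qed
  moreover have "inj_on pt (I \<times> A)"
    using pt_on_line_eq own_line by (metis inj_onI)
  moreover have "finite B"
    using B(2) finite_pg_points finite_subset
    by (auto simp: minimal_blocking_set_def blocking_set_def)
  ultimately have "card (I \<times> A) \<le> card B"
    by (metis card_image card_mono)
  with B(2) show ?thesis by (auto simp: card_cartesian_product)
qed

end

section \<open>Base \<open>T\<close> arithmetic of the tangency values\<close>

text \<open>The digits of the first factor list \<open>x\<close> in reverse order, so the
  \<open>T^3\<close> coefficient of the product is
  \<open>|y|^2 - |x|^2 - 2 x (y - x) = |y - x|^2\<close>. The witness collects the coefficients of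
  \<open>T^4\<close>, \<open>T^5\<close> and \<open>T^6\<close>.\<close>

lemma tangent_digit_expansion:
  fixes x0 x1 x2 y0 y1 y2 T :: int
  shows "\<exists>h. (1 - 2 * x2 * T - 2 * x1 * T^2 - 2 * x0 * T^3) *
      ((y0 + y1 * T + y2 * T^2 + (y0^2 + y1^2 + y2^2) * T^3) -
       (x0 + x1 * T + x2 * T^2 + (x0^2 + x1^2 + x2^2) * T^3)) =
    (y0 - x0) + ((y1 - x1) - 2 * x2 * (y0 - x0)) * T
      + ((y2 - x2) - 2 * x2 * (y1 - x1) - 2 * x1 * (y0 - x0)) * T^2
      + ((y0 - x0)^2 + (y1 - x1)^2 + (y2 - x2)^2) * T^3 + h * T^4"
  by (rule exI[of _ "(- 2 * x2 * ((y0^2 + y1^2 + y2^2) - (x0^2 + x1^2 + x2^2))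
      - 2 * x1 * (y2 - x2) - 2 * x0 * (y1 - x1))
    + (- 2 * x1 * ((y0^2 + y1^2 + y2^2) - (x0^2 + x1^2 + x2^2)) - 2 * x0 * (y2 - x2)) * T
    + (- 2 * x0 * ((y0^2 + y1^2 + y2^2) - (x0^2 + x1^2 + x2^2))) * T^2"])
    (simp add: algebra_simps eval_nat_numeral)

text \<open>The three lowest coefficients are at most \<open>m\<close>, \<open>3 m^2\<close> and
  \<open>5 m^2\<close> in absolute value. Their contributions to \<open>low\<close> are at most 1, 1
  and 5 times \<open>m^2 T^2\<close>, which is \<open>T^3 / 20\<close>. The coefficient
  \<open>mid\<close> is the squared distance of two distinct lattice points.\<close>

lemma tangent_value_low_digits:
  fixes x0 x1 x2 y0 y1 y2 m T :: int
  assumes box: "x0 \<in> {0..<m}" "x1 \<in> {0..<m}" "x2 \<in> {0..<m}" "y0 \<in> {0..<m}" "y1 \<in> {0..<m}" "y2 \<in> {0..<m}"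
    and neq: "(x0, x1, x2) \<noteq> (y0, y1, y2)" and T: "T = 20 * m^2"
  shows "\<exists>low mid h. (1 - 2 * x2 * T - 2 * x1 * T^2 - 2 * x0 * T^3) *
      ((y0 + y1 * T + y2 * T^2 + (y0^2 + y1^2 + y2^2) * T^3) -
       (x0 + x1 * T + x2 * T^2 + (x0^2 + x1^2 + x2^2) * T^3)) = low + mid * T^3 + h * T^4 \<and>
      20 * \<bar>low\<bar> \<le> 7 * T^3 \<and> 1 \<le> mid \<and> mid \<le> 3 * m^2"
proof -
  let ?d0 = "y0 - x0" and ?d1 = "y1 - x1" and ?d2 = "y2 - x2"
  have m: "m \<ge> 1" using box by auto
  then have mm: "m \<le> m^2" "1 \<le> m^2" by (simp_all add: self_le_power)
  have T20: "T \<ge> 20" using T mm by simp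
  have d: "\<bar>?d0\<bar> \<le> m" "\<bar>?d1\<bar> \<le> m" "\<bar>?d2\<bar> \<le> m" and x: "\<bar>x0\<bar> \<le> m" "\<bar>x1\<bar> \<le> m" "\<bar>x2\<bar> \<le> m"
    using box by auto
  have prod: "\<bar>a * b\<bar> \<le> m^2" if "\<bar>a\<bar> \<le> m" "\<bar>b\<bar> \<le> m" for a b :: int
    using mult_mono[OF that] m by (simp add: abs_mult power2_eq_square)
  define c1 where "c1 = ?d1 - 2 * x2 * ?d0"
  define c2 where "c2 = ?d2 - 2 * x2 * ?d1 - 2 * x1 * ?d0"
  define low where "low = ?d0 + c1 * T + c2 * T^2"
  define mid where "mid = ?d0^2 + ?d1^2 + ?d2^2"
  have c1: "\<bar>c1\<bar> \<le> 3 * m^2"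
    using prod[OF x(3) d(1)] d(2) mm unfolding c1_def mult.assoc by linarith
  have c2: "\<bar>c2\<bar> \<le> 5 * m^2"
    using prod[OF x(3) d(2)] prod[OF x(2) d(1)] d(3) mm unfolding c2_def mult.assoc
    by linarith
  have T1: "1 \<le> T^2" "3 * T \<le> T^2"
    using T20 one_le_power[of T 2] mult_right_mono[of 3 T T] by (simp_all add: power2_eq_square)
  have "\<bar>?d0\<bar> \<le> m^2 * T^2"
    using d(1) mm mult_mono[of "m^2" "m^2" 1 "T^2"] T1 by simp
  moreover have "\<bar>c1 * T\<bar> \<le> m^2 * T^2"
  proof -
    have "\<bar>c1 * T\<bar> \<le> 3 * m^2 * T" using c1 T20 by (simp add: abs_mult mult_right_mono)
    also have "\<dots> = m^2 * (3 * T)" by simp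
    also have "\<dots> \<le> m^2 * T^2" using T1 by (intro mult_left_mono) auto
    finally show ?thesis .
  qed
  moreover have "\<bar>c2 * T^2\<bar> \<le> 5 * (m^2 * T^2)"
    using c2 mult_right_mono[OF c2, of "T^2"] by (simp add: abs_mult)
  ultimately have "\<bar>low\<bar> \<le> 7 * (m^2 * T^2)" unfolding low_def by linarith
  moreover have "T^3 = 20 * (m^2 * T^2)" by (simp add: T eval_nat_numeral)
  ultimately have low: "20 * \<bar>low\<bar> \<le> 7 * T^3" by linarith
  have sq: "a^2 \<le> m^2" if "\<bar>a\<bar> \<le> m" for a :: int
    using prod[OF that that] by (simp add: power2_eq_square)
  have "mid \<le> 3 * m^2" using sq[OF d(1)] sq[OF d(2)] sq[OF d(3)] by (simp add: mid_def)
  moreover have "1 \<le> mid"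
  proof -
    have "mid \<noteq> 0" using neq unfolding mid_def
      by (metis (no_types, opaque_lifting) add_nonneg_eq_0_iff eq_iff_diff_eq_0 power2_eq_iff_nonneg
          zero_eq_power2 zero_le_power2 add_nonneg_nonneg)
    moreover have "mid \<ge> 0" by (simp add: mid_def)
    ultimately show ?thesis by simp
  qed
  moreover from tangent_digit_expansion[of x2 T x1 x0 y0 y1 y2] obtain h where
    "(1 - 2 * x2 * T - 2 * x1 * T^2 - 2 * x0 * T^3) *
      ((y0 + y1 * T + y2 * T^2 + (y0^2 + y1^2 + y2^2) * T^3) -
       (x0 + x1 * T + x2 * T^2 + (x0^2 + x1^2 + x2^2) * T^3)) = low + mid * T^3 + h * T^4"
    by (auto simp: low_def mid_def c1_def c2_def)
  ultimately show ?thesis using low by blast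
qed

text \<open>This size bound later excludes wrap-around modulo the prime. The factors are at most
  \<open>7 m T^3\<close> (7 = 1 + 2 + 2 + 2) and \<open>6 m^2 T^3\<close> (6 = 1 + 1 + 1 +
  3).\<close>

lemma tangent_value_bound:
  fixes x0 x1 x2 y0 y1 y2 m T :: int
  assumes box: "x0 \<in> {0..<m}" "x1 \<in> {0..<m}" "x2 \<in> {0..<m}" "y0 \<in> {0..<m}" "y1 \<in> {0..<m}" "y2 \<in> {0..<m}"
    and T: "T \<ge> 1"
  shows "\<bar>(1 - 2 * x2 * T - 2 * x1 * T^2 - 2 * x0 * T^3) *
      ((y0 + y1 * T + y2 * T^2 + (y0^2 + y1^2 + y2^2) * T^3) -
       (x0 + x1 * T + x2 * T^2 + (x0^2 + x1^2 + x2^2) * T^3))\<bar> \<le> 42 * m^3 * T^6"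
    (is "\<bar>?a * ?s\<bar> \<le> _")
proof -
  have m: "m \<ge> 1" using box by auto
  then have mm: "m \<le> m^2" by (simp add: self_le_power)
  have pow: "1 \<le> T^3" "T \<le> T^3" "T^2 \<le> T^3"
    using T power_increasing[of 0 3 T] power_increasing[of 1 3 T] power_increasing[of 2 3 T]
    by simp_all
  have digit: "a * b \<in> {0..M * T^3}" if "a \<in> {0..M}" "b \<in> {0..T^3}" for a b M :: int
    using that mult_mono[of a M b "T^3"] by simp
  have a: "\<bar>1 - 2 * x2 * T - 2 * x1 * T^2 - 2 * x0 * T^3\<bar> \<le> 7 * (m * T^3)"
  proof -
    have "x2 * T \<in> {0..m * T^3}" "x1 * T^2 \<in> {0..m * T^3}" "x0 * T^3 \<in> {0..m * T^3}" 
      using box pow T by (intro digit; auto)+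
    moreover have "1 \<le> m * T^3" using m pow(1) mult_mono[of 1 m 1 "T^3"] by simp
    ultimately show ?thesis by auto
  qed
  have s: "z0 + z1 * T + z2 * T^2 + (z0^2 + z1^2 + z2^2) * T^3 \<in> {0..6 * (m^2 * T^3)}"
    if z: "z0 \<in> {0..<m}" "z1 \<in> {0..<m}" "z2 \<in> {0..<m}" for z0 z1 z2
  proof -
    have sq: "a^2 \<le> m^2" if "a \<in> {0..<m}" for a using that by (auto intro: power_mono)
    have "z0^2 + z1^2 + z2^2 \<in> {0..3 * m^2}"
      using sq[OF z(1)] sq[OF z(2)] sq[OF z(3)] unfolding atLeastAtMost_iff
      by (intro conjI add_nonneg_nonneg zero_le_power2) linarith
    then have "z0 * 1 \<in> {0..m^2 * T^3}" "z1 * T \<in> {0..m^2 * T^3}" "z2 * T^2 \<in> {0..m^2 * T^3}"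
      "(z0^2 + z1^2 + z2^2) * T^3 \<in> {0..(3 * m^2) * T^3}"
      using z mm T pow by (intro digit; auto)+
    then show ?thesis by auto
  qed
  have "\<bar>(y0 + y1 * T + y2 * T^2 + (y0^2 + y1^2 + y2^2) * T^3) -
       (x0 + x1 * T + x2 * T^2 + (x0^2 + x1^2 + x2^2) * T^3)\<bar> \<le> 6 * (m^2 * T^3)"
    using s[OF box(1-3)] s[OF box(4-6)] by auto
  from mult_mono[OF a this] m T have "\<bar>?a * ?s\<bar> \<le> 7 * (m * T^3) * (6 * (m^2 * T^3))"
    unfolding abs_mult by simp
  also have "\<dots> = 42 * m^3 * T^6" by (simp add: eval_nat_numeral)
  finally show ?thesis .
qed

section \<open>Numbers with a small residue\<close>

text \<open>For \<open>0 < W \<le> Q\<close> these are the numbers in \<open>[0, Q H)\<close> whose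
  residue modulo \<open>Q\<close> is below \<open>W\<close>; writing them by remainder and quotient
  makes them easy to count.\<close>

definition digit_set :: "int \<Rightarrow> int \<Rightarrow> int \<Rightarrow> int set" where
  "digit_set W Q H = (\<lambda>(l, k). l + Q * k) ` ({0..<W} \<times> {0..<H})"

lemma digit_set_subset:
  assumes "W \<le> Q"
  shows "digit_set W Q H \<subseteq> {0..<Q * H}"
proof
  fix t assume "t \<in> digit_set W Q H"
  then obtain l k where t: "t = l + Q * k" and l: "l \<in> {0..<W}" and k: "k \<in> {0..<H}"
    by (auto simp: digit_set_def)
  have "Q * k \<le> Q * (H - 1)" "0 \<le> Q * k" using k l assms by (auto intro: mult_left_mono)
  with l assms show "t \<in> {0..<Q * H}" by (auto simp: t algebra_simps)
qed

lemma card_digit_set: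
  assumes "W \<le> Q"
  shows "card (digit_set W Q H) = nat W * nat H"
proof -
  have "inj_on (\<lambda>(l, k). l + Q * k) ({0..<W} \<times> {0..<H})"
  proof (rule inj_onI, clarify)
    fix l k l' k'
    assume l: "l \<in> {0..<W}" "l' \<in> {0..<W}" and eq: "l + Q * k = l' + Q * k'"
    from eq have "(l + Q * k) mod Q = (l' + Q * k') mod Q" by simp
    with l assms have "l = l'" by simp
    with eq l assms show "l = l' \<and> k = k'" by auto
  qed
  then show ?thesis by (simp add: digit_set_def card_image card_cartesian_product)
qed

text \<open>Both \<open>v\<close> and \<open>t' - t\<close> are below \<open>p / 2\<close> in
  absolute value, so divisibility would force their sum to be 0. Modulo \<open>T^4\<close> the sum
  is \<open>e\<close>, where \<open>mid * T^3\<close> lies between \<open>T^3\<close> and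
  \<open>3 T^4 / 20\<close>, and the other terms amount to less than
  \<open>7 T^3 / 20 + T^3 / 2 < T^3\<close>. Hence \<open>0 < e < T^4\<close>.\<close>

lemma digit_set_avoids:
  fixes m T p H low mid h t t' v :: int
  assumes T: "T = 20 * m^2" "m \<ge> 1" and H: "2 * T^4 * H \<le> p"
    and v: "v = low + mid * T^3 + h * T^4" "2 * \<bar>v\<bar> < p"
    and low: "20 * \<bar>low\<bar> \<le> 7 * T^3" and mid: "1 \<le> mid" "mid \<le> 3 * m^2"
    and t: "t \<in> digit_set (10 * m^2 * T^2) (T^4) H" "t' \<in> digit_set (10 * m^2 * T^2) (T^4) H"
  shows "\<not> p dvd v + (t' - t)"
proof
  assume dvd: "p dvd v + (t' - t)"
  obtain l k l' k' where t_eq: "t = l + T^4 * k" "t' = l' + T^4 * k'"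
    and l: "l \<in> {0..<10 * m^2 * T^2}" "l' \<in> {0..<10 * m^2 * T^2}"
    using t by (auto simp: digit_set_def)
  define e where "e = low + mid * T^3 + (l' - l)"
  define w where "w = v + (t' - t)"
  have T20: "T \<ge> 20" using T power_mono[of 1 m 2] by simp
  have T3: "T^3 > 0" using T20 by simp
  have half: "2 * (10 * m^2 * T^2) = T^3" by (simp add: T eval_nat_numeral)
  have T4: "T^4 = 20 * m^2 * T^3" by (simp add: T eval_nat_numeral)
  have T34: "20 * T^3 \<le> T^4" using T20 by (simp add: eval_nat_numeral)
  have "T^3 \<le> mid * T^3" "mid * T^3 \<le> 3 * m^2 * T^3"
    using mid T3 by (auto intro: mult_right_mono)
  then have e: "0 < e" "e < T^4"
    using low l half T4 T34 T3 unfolding e_def atLeastLessThan_iff by linarith+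
  have "w = e + T^4 * (h + k' - k)" by (simp add: w_def v(1) t_eq e_def algebra_simps)
  then have "w mod T^4 = e" using e by simp
  then have "w \<noteq> 0" using e by auto
  have "10 * m^2 * T^2 \<le> T^4" using half T3 T34 by linarith
  from t digit_set_subset[OF this] have "t \<in> {0..<T^4 * H}" "t' \<in> {0..<T^4 * H}" by blast+
  with v(2) H have "\<bar>w\<bar> < p" unfolding w_def by auto
  moreover have "\<bar>p\<bar> \<le> \<bar>w\<bar>"
    using dvd_imp_le_int[OF \<open>w \<noteq> 0\<close>] dvd by (simp only: w_def)
  ultimately show False by linarith
qed

section \<open>Choice of parameters and the final count\<close>

text \<open>With \<open>T = 20 m^2\<close> one has \<open>m^3 T^6 = 20^6 m^15\<close>. Twice the
  bound \<open>42 m^3 T^6\<close> must stay below \<open>q\<close>, and 85 exceeds 84.\<close>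

lemma minimal_blocking_set_from_box:
  fixes q m :: nat
  assumes q: "prime q" and m: "m \<ge> 1" and size: "85 * 20^6 * m^15 \<le> q"
  shows "\<exists>B. minimal_blocking_set (residue_ring (int q)) B \<and> m * q \<le> 160 * card B"
proof -
  interpret residues_prime q "residue_ring (int q)"
    using q by unfold_locales
  define M where "M = int m"
  define T where "T = 20 * M^2"
  \<comment> \<open>The largest \<open>H\<close> that keeps \<open>A\<close> inside
    \<open>[0, q/2)\<close>.\<close>
  define H where "H = int q div (2 * T^4)"
  define W where "W = 10 * M^2 * T^2"
  define I where "I = {0..<M} \<times> {0..<M} \<times> {0..<M}"
  define A where "A = digit_set W (T^4) H"
  define \<sigma> where "\<sigma> = (\<lambda>(x0, x1, x2). x0 + x1 * T + x2 * T^2 + (x0^2 + x1^2 + x2^2) * T^3)"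
  define \<alpha> where "\<alpha> = (\<lambda>(x0, x1, x2). 1 - 2 * x2 * T - 2 * x1 * T^2 - 2 * x0 * T^3)"
  have M: "M \<ge> 1" using m by (simp add: M_def)
  have T20: "T \<ge> 20" using power_mono[of 1 M 2] M by (simp add: T_def)
  have T4: "2 * W * T \<le> T^4" "T^4 = 400 * M^4 * T^2"
    by (simp_all add: W_def T_def eval_nat_numeral)
  have T3: "M^3 * T^6 = 20^6 * M^15" by (simp add: T_def eval_nat_numeral)
  have "int (85 * 20^6 * m^15) \<le> int q" using size by (simp only: of_nat_le_iff)
  then have qM: "85 * (M^3 * T^6) \<le> int q" unfolding T3 by (simp add: M_def)
  have pos: "0 < M^3 * T^6" using M T20 by simp
  have T_pos: "0 < 2 * T^4" using T20 by simp
  have H: "2 * T^4 * H \<le> int q" "int q < 2 * T^4 * (H + 1)"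
    using pos_mod_bound[OF T_pos, of "int q"] pos_mod_sign[OF T_pos, of "int q"]
      mult_div_mod_eq[of "2 * T^4" "int q"]
    unfolding H_def distrib_left by linarith+
  have W_nonneg: "0 \<le> W" by (simp add: W_def)
  have WT: "W \<le> T^4"
    using T4(1) T20 W_nonneg mult_left_mono[of 1 "2 * T" W] by simp
  have A_sub: "A \<subseteq> {0..<int q}"
    using digit_set_subset[OF WT, of H] H(1) T_pos by (fastforce simp: A_def)
  have tangent: "i = j"
    if i: "i \<in> I" and j: "j \<in> I" and t: "t \<in> A" "t' \<in> A"
      and dvd: "int q dvd \<alpha> i * (\<sigma> j - \<sigma> i) + (t' - t)" for i j t t'
  proof (rule ccontr)
    assume "i \<noteq> j"
    obtain x0 x1 x2 where x: "i = (x0, x1, x2)" by (cases i)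
    obtain y0 y1 y2 where y: "j = (y0, y1, y2)" by (cases j)
    have box: "x0 \<in> {0..<M}" "x1 \<in> {0..<M}" "x2 \<in> {0..<M}" "y0 \<in> {0..<M}" "y1 \<in> {0..<M}" "y2 \<in> {0..<M}"
      using i j by (auto simp: x y I_def)
    have "(x0, x1, x2) \<noteq> (y0, y1, y2)" using \<open>i \<noteq> j\<close> x y by simp
    from tangent_value_low_digits[OF box this T_def] obtain low mid h where
      v: "\<alpha> i * (\<sigma> j - \<sigma> i) = low + mid * T^3 + h * T^4" "20 * \<bar>low\<bar> \<le> 7 * T^3" "1 \<le> mid" "mid \<le> 3 * M^2"
      by (auto simp: x y \<alpha>_def \<sigma>_def)
    have "\<bar>\<alpha> i * (\<sigma> j - \<sigma> i)\<bar> \<le> 42 * M^3 * T^6"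
      using tangent_value_bound[OF box, of T] T20 by (simp add: x y \<alpha>_def \<sigma>_def)
    with qM pos have "2 * \<bar>\<alpha> i * (\<sigma> j - \<sigma> i)\<bar> < int q" by linarith
    from digit_set_avoids[OF T_def M H(1) v(1) this v(2-4)] t dvd show False
      by (auto simp: A_def W_def)
  qed
  have "\<exists>B. minimal_blocking_set (residue_ring (int q)) B \<and> card I * card A \<le> card B"
    by (rule minimal_blocking_set_from_tangents[of A I \<alpha> \<sigma>]) (fact A_sub, rule tangent)
  then obtain B where B: "minimal_blocking_set (residue_ring (int q)) B" "card I * card A \<le> card B"
    by blast
  \<comment> \<open>Once \<open>q\<close> is at least \<open>4 T^4\<close>, rounding down in
    \<open>H\<close> costs at most a factor 2.\<close>
  have "4 * T^4 \<le> 85 * (M^3 * T^6)"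
  proof -
    have "1 * T^4 \<le> M^3 * T^6"
      using M T20 by (intro mult_mono one_le_power power_increasing) auto
    then show ?thesis using pos by simp
  qed
  then have "int q \<le> 4 * T^4 * H" using H qM by (simp add: algebra_simps)
  then have "M * int q \<le> M * (4 * T^4 * H)" using M by (intro mult_left_mono) auto
  also have "\<dots> = 160 * (M^3 * (W * H))"
    unfolding T4(2) by (simp add: W_def eval_nat_numeral)
  also have "M^3 * (W * H) = int (card I * card A)"
    using M W_nonneg T20 card_digit_set[OF WT, of H]
    by (simp add: A_def I_def H_def card_cartesian_product eval_nat_numeral pos_imp_zdiv_nonneg_iff)
  finally have "int (m * q) \<le> int (160 * (card I * card A))"
    by (simp add: M_def)
  then have "m * q \<le> 160 * (card I * card A)" by (simp only: of_nat_le_iff)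
  with B show ?thesis by (meson le_trans mult_le_mono2)
qed

text \<open>Serves the small primes. A single chosen line suffices, as the tangency condition is
  trivial for a one-element index type.\<close>

lemma ex_nonempty_minimal_blocking_set:
  assumes "prime q"
  shows "\<exists>B. minimal_blocking_set (residue_ring (int q)) B \<and> 1 \<le> card B"
proof -
  interpret residues_prime q "residue_ring (int q)"
    using assms by unfold_locales
  show ?thesis
    using minimal_blocking_set_from_tangents[of "{0}" "{()}" "\<lambda>_. 0" "\<lambda>_. 0"] m_gt_one by auto
qed

theorem theorem1p13:
  "\<exists>c c' :: real. c > 0 \<and> c' > 0 \<and>
     (\<forall>q::nat. prime q \<longrightarrow>
        (\<exists>B. minimal_blocking_set (residue_ring (int q)) B \<and>
             real (card B) \<ge> c' * real q powr (1 + c)) \<and>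
        real (max_minimal_blocking_size (residue_ring (int q))) \<ge> c' * real q powr (1 + c))"
proof -
  \<comment> \<open>The constant of the size condition on the box, and the threshold for small
    \<open>q\<close>: below it \<open>q powr (1 + 1/15) \<le> q^2 \<le> C^2\<close>, so one point is
    enough.\<close>
  define C :: real where "C = 85 * 20^6"
  have C: "C \<ge> 320" by (simp add: C_def)
  have large: "\<exists>B. minimal_blocking_set (residue_ring (int q)) B \<and>
      real (card B) \<ge> 1 / C^2 * real q powr (1 + 1/15)" if q: "prime q" for q :: nat
  proof (cases "real q < C")
    case True
    have q1: "real q \<ge> 1" using prime_ge_1_nat[OF q] by simp
    have "real q powr (1 + 1/15) \<le> real q powr 2" using q1 by (intro powr_mono) auto
    also have "\<dots> = (real q)^2" using q1 by simp
    also have "\<dots> \<le> C^2" using True by (intro power_mono) auto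
    finally have "1 / C^2 * real q powr (1 + 1/15) \<le> 1" using C by (simp add: field_simps)
    moreover obtain B where "minimal_blocking_set (residue_ring (int q)) B" "1 \<le> card B"
      using ex_nonempty_minimal_blocking_set[OF q] by blast
    ultimately show ?thesis by (intro exI[of _ B]) linarith
  next
    case False
    \<comment> \<open>The real solution of \<open>C r^15 = q\<close>; its floor is the largest
      admissible box side, and rounding loses at most a factor 2 since
      \<open>r \<ge> 1\<close>.\<close>
    define r where "r = (real q / C) powr (1/15)"
    define m where "m = nat \<lfloor>r\<rfloor>"
    have qC: "real q / C \<ge> 1" using False C by simp
    then have r: "r \<ge> 1" by (simp add: r_def ge_one_powr_ge_zero)
    then have "m \<ge> 1" "real m \<le> r" "r < real m + 1"
      unfolding m_def by linarith+
    then have m: "m \<ge> 1" "real m \<le> r" "r \<le> 2 * real m" by simp_all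
    have "r ^ 15 = real q / C"
      using C qC by (simp add: r_def powr_powr flip: powr_realpow')
    then have "real m ^ 15 \<le> real q / C" using power_mono[OF m(2), of 15] by simp
    then have "real (85 * 20^6 * m^15) \<le> real q" using C by (simp add: C_def field_simps)
    then have "85 * 20^6 * m^15 \<le> q" by (simp only: of_nat_le_iff)
    from minimal_blocking_set_from_box[OF q m(1) this] obtain B where
      B: "minimal_blocking_set (residue_ring (int q)) B" "m * q \<le> 160 * card B" by blast
    have "real (m * q) \<le> real (160 * card B)" using B(2) by (simp only: of_nat_le_iff)
    then have mq: "real q * (2 * real m) \<le> 320 * real (card B)" by simp
    have "real q powr (1/15) = C powr (1/15) * r"
      using C qC by (simp add: r_def powr_divide)
    also have "\<dots> \<le> C powr 1 * (2 * real m)"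
      using C r m by (intro mult_mono powr_mono) auto
    finally have "real q * real q powr (1/15) \<le> real q * (C * (2 * real m))"
      using C by (intro mult_left_mono) auto
    also have "\<dots> \<le> C * (320 * real (card B))"
      using mult_left_mono[OF mq, of C] C by (simp add: algebra_simps)
    \<comment> \<open>The factor 320 = 2 * 160 is absorbed into a second factor
      \<open>C\<close>.\<close>
    also have "\<dots> \<le> C * (C * real (card B))"
      using C by (intro mult_left_mono mult_right_mono) auto
    finally have "real q powr (1 + 1/15) \<le> C^2 * real (card B)"
      unfolding powr_add by (simp add: power2_eq_square mult.assoc)
    then have "1 / C^2 * real q powr (1 + 1/15) \<le> real (card B)"
      using C by (simp add: field_simps)
    with B(1) show ?thesis by blast
  qed
  have max: "card B \<le> max_minimal_blocking_size (residue_ring (int q))"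
    if "prime q" "minimal_blocking_set (residue_ring (int q)) B" for q :: nat and B
  proof -
    interpret residues_prime q "residue_ring (int q)"
      using that(1) by unfold_locales
    show ?thesis
      using that(2) finite_minimal_blocking_sets by (auto simp: max_minimal_blocking_size_def)
  qed
  show ?thesis
  proof (rule exI[of _ "1/15"], rule exI[of _ "1 / C^2"], intro conjI allI impI)
    fix q :: nat assume q: "prime q"
    from large[OF q] obtain B where B: "minimal_blocking_set (residue_ring (int q)) B"
      "real (card B) \<ge> 1 / C^2 * real q powr (1 + 1/15)"
      by blast
    then show "\<exists>B. minimal_blocking_set (residue_ring (int q)) B \<and>
        real (card B) \<ge> 1 / C^2 * real q powr (1 + 1/15)"
      by blast
    have "real (card B) \<le> real (max_minimal_blocking_size (residue_ring (int q)))"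
      using max[OF q B(1)] by simp
    with B(2) show "real (max_minimal_blocking_size (residue_ring (int q))) \<ge> 1 / C^2 * real q powr (1 + 1/15)"
      by linarith
  qed (use C in auto)
qed

end
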